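(* Let $p$ be a prime with $p\equiv 1\pmod 4$, and let $a\in\mathbb{Z}$ with $p\nmid a$. Then $$\left|\left\{(j,k):\ 1\le j<k\le\tfrac{p-1}2,\ \{aj^2\}_p>\{ak^2\}_p\right\}\right|+\left|\left\{(j,k):\ 1\le j<k\le\tfrac{p-1}2,\ \{ak^2-aj^2\}_p>\tfrac p2\right\}\right|$$ $$\equiv\left|\left\{k\in\mathbb{Z}:\ 1\le k<\tfrac p4,\ \left(\tfrac kp\right)=\left(\tfrac ap\right)\right\}\right|\pmod 2.$$
   Context: For an integer $x$, $\{x\}_p$ denotes the least nonnegative residue of $x$ modulo $p$. $\left(\frac{\cdot}{p}\right)$ is the Legendre symbol. The pairs $(j,k)$ are ordered pairs of integers. *)

theory Defs
  imports Complex_Main "HOL-Number_Theory.Number_Theory"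
begin

end

theory Submission
  imports Defs
begin

text \<open>
  Let \<open>x\<^sub>j\<close> be the least residue of \<open>a j\<^sup>2\<close>. For a single pair \<open>j < k\<close>, the two conditions counted on
  the left hold with total multiplicity congruent mod 2 to 1 or 0 according to whether
  \<open>\<bar>x\<^sub>j - x\<^sub>k\<bar> > p/2\<close> or not. So the left side counts, mod 2, the pairs \<open>r < s\<close> with \<open>s - r > p/2\<close> in the set
  \<open>R\<close> of residues having the same Legendre symbol as \<open>a\<close>. As \<open>-1\<close> is a square, \<open>R\<close> is stable under
  \<open>r \<mapsto> p - r\<close>, and \<open>(r, s) \<mapsto> (p - s, p - r)\<close> is an involution on these pairs. Its fixed points
  \<open>(r, p - r)\<close> are given by the \<open>r \<in> R\<close> with \<open>p - 2r > p/2\<close>, that is \<open>r < p/4\<close>.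
\<close>

lemma Legendre_cong:
  assumes "[a = b] (mod p)"
  shows "Legendre a p = Legendre b p"
proof -
  have "QuadRes p a \<longleftrightarrow> QuadRes p b"
    unfolding QuadRes_def using assms cong_trans cong_sym by blast
  moreover have "[a = 0] (mod p) \<longleftrightarrow> [b = 0] (mod p)"
    using assms cong_trans cong_sym by blast
  ultimately show ?thesis unfolding Legendre_def by simp
qed

lemma Legendre_values: "Legendre a p \<in> {-1, 0, 1}"
  by (simp add: Legendre_def)

text \<open>Two such values differ by at most 2, which is less than \<open>p\<close>. This turns the
  congruences from Euler's criterion into equalities of Legendre symbols.\<close>

lemma sign_values_cong_imp_eq:
  fixes u v p :: int
  assumes "u \<in> {-1, 0, 1}" "v \<in> {-1, 0, 1}" "2 < p" "[u = v] (mod p)"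
  shows "u = v"
proof (rule ccontr)
  assume "u \<noteq> v"
  moreover have "p dvd u - v" using assms(4) by (simp add: cong_iff_dvd_diff)
  ultimately have "\<bar>p\<bar> \<le> \<bar>u - v\<bar>" using dvd_imp_le_int by simp
  with assms(1-3) show False by auto
qed

lemma euler_criterion_int:
  fixes p a :: int
  assumes "prime p" "2 < p"
  shows "[Legendre a p = a ^ (nat (p - 1) div 2)] (mod p)"
proof -
  have "prime (nat p)" using assms(1) by (simp only: prime_int_nat_transfer)
  moreover have "2 < nat p" using assms(2) by simp
  ultimately have "[Legendre a (int (nat p)) = a ^ ((nat p - 1) div 2)] (mod int (nat p))"
    by (rule euler_criterion)
  moreover have "nat (p - 1) = nat p - 1" "int (nat p) = p" using assms(2) by auto
  ultimately show ?thesis by (simp only:)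
qed

text \<open>By Euler's criterion both sides are congruent to the same power of \<open>a * b\<close>,
  and both lie in \<open>{-1, 0, 1}\<close>.\<close>

lemma Legendre_mult:
  fixes p a b :: int
  assumes "prime p" "2 < p"
  shows "Legendre (a * b) p = Legendre a p * Legendre b p"
proof (rule sign_values_cong_imp_eq[OF _ _ assms(2)])
  show "Legendre (a * b) p \<in> {-1, 0, 1}" by (rule Legendre_values)
  show "Legendre a p * Legendre b p \<in> {-1, 0, 1}"
    using Legendre_values[of a p] Legendre_values[of b p] by auto
  have "[Legendre a p * Legendre b p = a ^ (nat (p - 1) div 2) * b ^ (nat (p - 1) div 2)] (mod p)"
    by (intro cong_mult euler_criterion_int assms)
  moreover have "[Legendre (a * b) p = (a * b) ^ (nat (p - 1) div 2)] (mod p)"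
    by (intro euler_criterion_int assms)
  ultimately show "[Legendre (a * b) p = Legendre a p * Legendre b p] (mod p)"
    unfolding power_mult_distrib using cong_trans cong_sym by blast
qed

text \<open>For \<open>p\<close> congruent to 1 mod 4 the exponent \<open>(p - 1) / 2\<close> in
  Euler's criterion is even, so -1 has symbol 1.\<close>

lemma Legendre_minus:
  fixes p a :: int
  assumes "prime p" "2 < p" "[p = 1] (mod 4)"
  shows "Legendre (- a) p = Legendre a p"
proof -
  have "p mod 4 = 1" using assms(3) by (simp add: cong_def)
  then have "p - 1 = 4 * (p div 4)" using div_mult_mod_eq[of p 4] by simp
  then have "nat (p - 1) = 4 * nat (p div 4)" by simp
  then have "even (nat (p - 1) div 2)" by simp
  then have "[Legendre (- 1) p = 1] (mod p)"
    using euler_criterion_int[OF assms(1,2), of "- 1"] by simp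
  then have "Legendre (- 1) p = 1"
    using sign_values_cong_imp_eq[OF Legendre_values _ assms(2)] by blast
  then show ?thesis using Legendre_mult[OF assms(1,2), of "- 1" a] by simp
qed

text \<open>This replaces indices \<open>j\<close> by residues. Injectivity: \<open>p\<close> must
  divide \<open>j - k\<close> or \<open>j + k\<close>, and \<open>j + k\<close> lies strictly
  between 0 and \<open>p\<close>. Surjectivity: if \<open>r\<close> and \<open>a\<close> have the
  same symbol, then \<open>a * r\<close> is a square, and dividing its root by \<open>a\<close>
  gives a preimage up to sign.\<close>

lemma bij_betw_scaled_squares:
  fixes p a :: int
  assumes p: "prime p" "2 < p" and a: "\<not> p dvd a"
  shows "bij_betw (\<lambda>j. (a * j\<^sup>2) mod p) {1..(p - 1) div 2}
           {r. 0 < r \<and> r < p \<and> Legendre r p = Legendre a p}"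
    (is "bij_betw ?f ?I ?R")
proof (rule bij_betw_imageI)
  have "odd p" using p prime_odd_int by auto
  show "inj_on ?f ?I"
  proof (rule inj_onI)
    fix j k assume jk: "j \<in> ?I" "k \<in> ?I" "?f j = ?f k"
    then have "p dvd a * j\<^sup>2 - a * k\<^sup>2" by (simp add: mod_eq_dvd_iff)
    also have "a * j\<^sup>2 - a * k\<^sup>2 = a * ((j - k) * (j + k))"
      by (simp add: algebra_simps power2_eq_square)
    finally have "p dvd j - k \<or> p dvd j + k"
      using p(1) a by (simp add: prime_dvd_mult_iff)
    moreover have "0 < j + k" "j + k < p" using jk p(2) \<open>odd p\<close> by (auto elim!: oddE)
    then have "\<not> p dvd j + k" using zdvd_not_zless by blast
    ultimately have "p dvd j - k" by simp
    moreover have "\<bar>j - k\<bar> < \<bar>p\<bar>" using jk by auto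
    ultimately show "j = k" using dvd_imp_le_int[of "j - k" p] by fastforce
  qed
  show "?f ` ?I = ?R"
  proof (intro subset_antisym subsetI)
    fix r assume "r \<in> ?f ` ?I"
    then obtain j where j: "j \<in> ?I" and r: "r = ?f j" by blast
    have "\<not> p dvd j" using j p by (auto dest: zdvd_imp_le)
    then have "\<not> p dvd a * j\<^sup>2"
      using a p(1) by (simp add: prime_dvd_mult_iff prime_dvd_power_iff)
    then have "r \<noteq> 0" using r by (simp add: dvd_eq_mod_eq_0)
    moreover have "Legendre j p * Legendre j p = 1"
      using \<open>\<not> p dvd j\<close> by (simp add: Legendre_def cong_0_iff)
    then have "Legendre (a * j\<^sup>2) p = Legendre a p"
      by (simp add: Legendre_mult[OF p] power2_eq_square)
    then have "Legendre r p = Legendre a p"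
      using r Legendre_cong[of r "a * j\<^sup>2" p] by (simp add: cong_def)
    moreover have "0 \<le> r" "r < p" using r p(2) by auto
    ultimately show "r \<in> ?R" by simp
  next
    fix r assume "r \<in> ?R"
    then have r: "0 < r" "r < p" and Lr: "Legendre r p = Legendre a p" by auto
    have "Legendre a p * Legendre a p = 1"
      using a by (simp add: Legendre_def cong_0_iff)
    then have "Legendre (a * r) p = 1" using Lr by (simp add: Legendre_mult[OF p])
    then obtain y where y: "[y\<^sup>2 = a * r] (mod p)"
      unfolding Legendre_def QuadRes_def by (auto split: if_splits)
    have "coprime a p" using p(1) a prime_imp_coprime coprime_commute by blast
    then obtain b where b: "[a * b = 1] (mod p)" using cong_solve_coprime_int by blast
    \<comment> \<open>As \<open>b\<close> inverts \<open>a\<close> and \<open>y\<close> is a root of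
      \<open>a * r\<close>, the quotient \<open>y / a\<close> satisfies
      \<open>a * (y / a)\<^sup>2 = r\<close> modulo \<open>p\<close>.\<close>
    define i where "i = (y * b) mod p"
    have "[a * i\<^sup>2 = a * (y * b)\<^sup>2] (mod p)"
      unfolding i_def by (intro cong_mult cong_pow) (auto simp: cong_def)
    also have "a * (y * b)\<^sup>2 = a * b * b * y\<^sup>2" by (simp add: power2_eq_square)
    also have "[a * b * b * y\<^sup>2 = a * b * b * (a * r)] (mod p)"
      using y by (intro cong_mult) auto
    also have "a * b * b * (a * r) = (a * b) * (a * b) * r" by simp
    also have "[(a * b) * (a * b) * r = 1 * 1 * r] (mod p)"
      using b by (intro cong_mult) auto
    finally have i: "?f i = r" using r by (simp add: cong_def)
    then have "i \<noteq> 0" using r by auto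
    then have i_range: "0 < i" "i < p" using p(2) unfolding i_def
      by (auto simp: order.not_eq_order_implies_strict)
    show "r \<in> ?f ` ?I"
    proof (cases "i \<le> (p - 1) div 2")
      case True
      then show ?thesis using i i_range by auto
    next
      case False
      \<comment> \<open>A root in the upper half is reflected to the lower half, which leaves its
        square unchanged modulo \<open>p\<close>.\<close>
      have "[a * (p - i)\<^sup>2 = a * i\<^sup>2] (mod p)"
        by (simp add: cong_iff_dvd_diff power2_diff algebra_simps)
      then have "?f (p - i) = r" using i by (simp add: cong_def)
      moreover have "p - i \<in> ?I" using False i_range \<open>odd p\<close> by (auto elim!: oddE)
      ultimately show ?thesis by blast
    qed
  qed
qed

text \<open>Split the pairs by comparing \<open>r + s\<close> with \<open>p\<close>. The reflection
  \<open>(r, s) \<mapsto> (p - s, p - r)\<close> keeps \<open>s - r\<close> and exchanges the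
  classes below and above \<open>p\<close>, so these contribute an even number. On the class
  \<open>s = p - r\<close> the condition becomes \<open>4 * r < p\<close>.\<close>

lemma card_far_pairs_parity:
  fixes S :: "int set" and p :: int
  assumes fin: "finite S" and refl: "\<And>r. r \<in> S \<Longrightarrow> p - r \<in> S"
  shows "[card {(r, s). r \<in> S \<and> s \<in> S \<and> p < 2 * (s - r)} = card {r \<in> S. 4 * r < p}] (mod 2)"
proof -
  let ?P = "\<lambda>r s. r \<in> S \<and> s \<in> S \<and> p < 2 * (s - r)"
  let ?E = "{(r, s). ?P r s \<and> r + s = p}"
  let ?L = "{(r, s). ?P r s \<and> r + s < p}"
  let ?G = "{(r, s). ?P r s \<and> r + s > p}"
  have fins: "finite ?E" "finite ?L" "finite ?G"
    by (rule finite_subset[OF _ finite_cartesian_product[OF fin fin]]; auto)+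
  have "{(r, s). ?P r s} = ?E \<union> (?L \<union> ?G)" by auto
  then have "card {(r, s). ?P r s} = card ?E + card (?L \<union> ?G)"
    using fins by (simp only:) (rule card_Un_disjoint; auto)
  also have "card (?L \<union> ?G) = card ?L + card ?G"
    using fins by (intro card_Un_disjoint) auto
  also have "card ?L = card ?G"
    by (rule bij_betw_same_card[where f = "\<lambda>(r, s). (p - s, p - r)"],
        rule bij_betw_byWitness[where f' = "\<lambda>(r, s). (p - s, p - r)"]) (auto intro: refl)
  also have "card ?E = card {r \<in> S. 4 * r < p}"
    by (rule bij_betw_same_card[where f = fst],
        rule bij_betw_byWitness[where f' = "\<lambda>r. (r, p - r)"]) (auto intro: refl)
  finally have "card {(r, s). ?P r s} = card {r \<in> S. 4 * r < p} + 2 * card ?G" by simp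
  then show ?thesis unfolding cong_def by (simp only: mod_mult_self2)
qed

text \<open>Index pairs are ordered by \<open>j < k\<close>, residue pairs by size. Swapping the
  coordinates of the pairs with \<open>x j > x k\<close> drops the index order in favour of the
  order of the values, and \<open>x\<close> then carries the pairs over to \<open>R\<close>.\<close>

lemma card_ordered_pairs_image:
  fixes x :: "int \<Rightarrow> int" and p :: int
  assumes bij: "bij_betw x I R" and fin: "finite I" and p: "0 \<le> p"
  shows "card {(j, k). j \<in> I \<and> k \<in> I \<and> j < k \<and> p < 2 * \<bar>x k - x j\<bar>}
       = card {(r, s). r \<in> R \<and> s \<in> R \<and> p < 2 * (s - r)}"
proof -
  let ?U = "{(j, k). j \<in> I \<and> k \<in> I \<and> j < k \<and> p < 2 * (x k - x j)}"
  let ?D = "{(j, k). j \<in> I \<and> k \<in> I \<and> j < k \<and> p < 2 * (x j - x k)}"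
  let ?D' = "{(j, k). j \<in> I \<and> k \<in> I \<and> k < j \<and> p < 2 * (x k - x j)}"
  let ?B = "{(j, k). j \<in> I \<and> k \<in> I \<and> p < 2 * (x k - x j)}"
  have fins: "finite ?U" "finite ?D" "finite ?D'"
    by (rule finite_subset[OF _ finite_cartesian_product[OF fin fin]]; auto)+
  have "{(j, k). j \<in> I \<and> k \<in> I \<and> j < k \<and> p < 2 * \<bar>x k - x j\<bar>} = ?U \<union> ?D"
    using p by (auto simp: abs_if)
  then have "card {(j, k). j \<in> I \<and> k \<in> I \<and> j < k \<and> p < 2 * \<bar>x k - x j\<bar>} = card ?U + card ?D"
    using fins p by (simp only:) (rule card_Un_disjoint; auto)
  also have "card ?D = card ?D'"
    by (rule bij_betw_same_card[where f = prod.swap],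
        rule bij_betw_byWitness[where f' = prod.swap]) auto
  also have "card ?U + card ?D' = card (?U \<union> ?D')"
    using fins by (intro card_Un_disjoint[symmetric]) auto
  \<comment> \<open>The diagonal \<open>j = k\<close> is missing on the left; it cannot occur in
    \<open>?B\<close> because \<open>p\<close> is nonnegative.\<close>
  also have "?U \<union> ?D' = ?B"
    using p by (auto simp: not_less) (metis diff_self linorder_cases not_le)
  also have "card ?B = card {(r, s). r \<in> R \<and> s \<in> R \<and> p < 2 * (s - r)}"
  proof (rule bij_betw_same_card[where f = "map_prod x x"], rule bij_betw_imageI)
    show "inj_on (map_prod x x) ?B"
      using bij by (auto simp: inj_on_def bij_betw_def)
    show "map_prod x x ` ?B = {(r, s). r \<in> R \<and> s \<in> R \<and> p < 2 * (s - r)}"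
      using bij by (force simp: bij_betw_def)
  qed
  finally show ?thesis .
qed

text \<open>The sum counts the elements of the intersection twice.\<close>

lemma card_symmetric_difference_parity:
  assumes "finite A" "finite B"
  shows "[card A + card B = card ((A - B) \<union> (B - A))] (mod 2)"
proof -
  have "card ((A - B) \<union> (B - A)) = card (A - B) + card (B - A)"
    using assms by (intro card_Un_disjoint) auto
  moreover have "card A = card (A \<inter> B) + card (A - B)"
    using card_Int_Diff[OF assms(1)] .
  moreover have "card B = card (A \<inter> B) + card (B - A)"
    using card_Int_Diff[OF assms(2), of A] by (simp add: Int_commute)
  ultimately show ?thesis by (simp add: cong_def) presburger
qed

theorem theorem1p2:
  fixes p a :: int
  assumes "prime p"
    and "[p = 1] (mod 4)"
    and "\<not> p dvd a"
  shows "[card {(j :: int, k :: int). 1 \<le> j \<and> j < k \<and> k \<le> (p - 1) div 2 \<and>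
                   (a * j\<^sup>2) mod p > (a * k\<^sup>2) mod p}
        + card {(j :: int, k :: int). 1 \<le> j \<and> j < k \<and> k \<le> (p - 1) div 2 \<and>
                   real_of_int ((a * k\<^sup>2 - a * j\<^sup>2) mod p) > real_of_int p / 2}
        = card {k :: int. 1 \<le> k \<and> real_of_int k < real_of_int p / 4 \<and> Legendre k p = Legendre a p}] (mod 2)"
    (is "[card ?A + card ?B = card ?C] (mod 2)")
proof -
  have "p mod 4 = 1" using assms(2) by (simp add: cong_def)
  then have "odd p" by presburger
  have "p > 1" using assms(1) prime_gt_1_int by blast
  with \<open>odd p\<close> have p2: "2 < p" by (cases "p = 2") auto
  define I where "I = {1..(p - 1) div 2}"
  define x where "x j = (a * j\<^sup>2) mod p" for j
  define R where "R = {r. 0 < r \<and> r < p \<and> Legendre r p = Legendre a p}"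
  have bij: "bij_betw x I R"
    unfolding x_def I_def R_def by (rule bij_betw_scaled_squares[OF assms(1) p2 assms(3)])
  have finI: "finite I" by (simp add: I_def)
  have finR: "finite R" using bij finI bij_betw_finite by blast
  have refl: "p - r \<in> R" if "r \<in> R" for r
  proof -
    have "Legendre (p - r) p = Legendre (- r) p"
      by (rule Legendre_cong) (simp add: cong_iff_dvd_diff)
    then show ?thesis
      using that Legendre_minus[OF assms(1) p2 assms(2), of r] by (auto simp: R_def)
  qed
  have half: "real_of_int n > real_of_int p / 2 \<longleftrightarrow> p < 2 * n" for n
    by (simp add: field_simps) linarith
  \<comment> \<open>The inequality of truth values is an exclusive or. If \<open>x k < x j\<close>,
    reduction adds \<open>p\<close> to the negative difference, so the second condition says
    \<open>x j - x k < p/2\<close> and fails exactly for far values. Otherwise the difference is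
    already reduced and only the second condition can hold.\<close>
  have far: "(x k < x j) \<noteq> (p < 2 * ((a * k\<^sup>2 - a * j\<^sup>2) mod p)) \<longleftrightarrow> p < 2 * \<bar>x k - x j\<bar>"
    for j k
  proof -
    have xj: "0 \<le> x j" "x j < p" and xk: "0 \<le> x k" "x k < p"
      using p2 by (auto simp: x_def)
    have diff: "(a * k\<^sup>2 - a * j\<^sup>2) mod p = (x k - x j) mod p"
      by (simp add: x_def mod_diff_eq)
    show ?thesis
    proof (cases "x k < x j")
      case True
      then have "(x k - x j) mod p = (x k - x j + p) mod p" by simp
      also have "\<dots> = x k - x j + p" using True xj xk by (intro mod_pos_pos_trivial) auto
      finally have "(x k - x j) mod p = x k - x j + p" .
      \<comment> \<open>Since \<open>p\<close> is odd, a difference of exactly \<open>p/2\<close> is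
        impossible, so negating the strict inequality again gives a strict one.\<close>
      moreover have "p \<noteq> 2 * (x j - x k)" using \<open>odd p\<close> by auto
      ultimately show ?thesis using True unfolding diff by auto
    next
      case False
      then have "(x k - x j) mod p = x k - x j" using xj xk by (intro mod_pos_pos_trivial) auto
      then show ?thesis using False unfolding diff by simp
    qed
  qed
  have A: "?A = {(j, k). j \<in> I \<and> k \<in> I \<and> j < k \<and> x k < x j}"
    by (auto simp: I_def x_def)
  have B: "?B = {(j, k). j \<in> I \<and> k \<in> I \<and> j < k \<and> p < 2 * ((a * k\<^sup>2 - a * j\<^sup>2) mod p)}"
    unfolding half by (auto simp: I_def)
  have "finite ?A" "finite ?B"
    unfolding A B by (rule finite_subset[OF _ finite_cartesian_product[OF finI finI]]; auto)+
  then have "[card ?A + card ?B = card ((?A - ?B) \<union> (?B - ?A))] (mod 2)"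
    by (rule card_symmetric_difference_parity)
  also have "(?A - ?B) \<union> (?B - ?A) = {(j, k). j \<in> I \<and> k \<in> I \<and> j < k \<and> p < 2 * \<bar>x k - x j\<bar>}"
    unfolding A B far[symmetric] by auto
  also have "card \<dots> = card {(r, s). r \<in> R \<and> s \<in> R \<and> p < 2 * (s - r)}"
    using card_ordered_pairs_image[OF bij finI] p2 by simp
  also have "[\<dots> = card {r \<in> R. 4 * r < p}] (mod 2)"
    by (rule card_far_pairs_parity[OF finR refl])
  \<comment> \<open>The bound \<open>r < p\<close> in \<open>R\<close> follows from
    \<open>4 * r < p\<close> and \<open>r > 0\<close>.\<close>
  also have "{r \<in> R. 4 * r < p} = ?C"
    by (auto simp: R_def field_simps)
  finally show ?thesis .
qed

end
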